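(* Let $(\mathcal A,\psi)$ be an algebra over a field $\Bbbk$, let $d$ be a derivation of $(\mathcal A,\psi)$, and put $D=d^2=d\circ d$. Then for every $n\ge 1$ the $n$-th derived operation of $\psi$ with respect to $D$ is given by $$\psi^{(n)}_D(x,y)=2^n\,\psi\bigl(d^n(x),d^n(y)\bigr)\qquad\text{for all }x,y\in\mathcal A .$$
   Context: An algebra $(\mathcal A,\psi)$ is a $\Bbbk$-vector space $\mathcal A$ (not necessarily finite-dimensional) with an arbitrary bilinear operation $\psi:\mathcal A\times\mathcal A\to\mathcal A$. For a linear map $D:\mathcal A\to\mathcal A$, the derived operation of $\psi$ with respect to $D$ is $$\psi'_D(x,y)=D(\psi(x,y))-\psi(Dx,y)-\psi(x,Dy).$$ The $n$-th derived operation is obtained by iteration: $\psi^{(1)}_D=\psi'_D$ and $\psi^{(n)}_D=(\psi^{(n-1)}_D)'_D$ for $n\ge2$. A derivation of $(\mathcal A,\psi)$ is a linear map $d:\mathcal A\to\mathcal A$ with $\psi'_d=0$. *)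

theory Defs
  imports Complex_Main
begin

text \<open>No associativity, commutativity, unit or finite dimension is assumed. The name
  \<open>linear\<close> alone would mean real-linear here, hence the qualified \<open>Vector_Spaces.linear\<close>.\<close>

locale nonassoc_algebra = vector_space scale
  for scale :: "'k::field \<Rightarrow> 'a::ab_group_add \<Rightarrow> 'a" +
  fixes \<psi> :: "'a \<Rightarrow> 'a \<Rightarrow> 'a"
  assumes linear_left: "\<And>y. Vector_Spaces.linear scale scale (\<lambda>x. \<psi> x y)"
    and linear_right: "\<And>x. Vector_Spaces.linear scale scale (\<lambda>y. \<psi> x y)"

definition derived_op :: "('a::ab_group_add \<Rightarrow> 'a) \<Rightarrow> ('a \<Rightarrow> 'a \<Rightarrow> 'a) \<Rightarrow> 'a \<Rightarrow> 'a \<Rightarrow> 'a" where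
  "derived_op D \<psi> = (\<lambda>x y. D (\<psi> x y) - \<psi> (D x) y - \<psi> x (D y))"

text \<open>The value at \<open>n = 0\<close> is \<open>\<psi>\<close> itself.\<close>

definition nth_derived_op ::
    "('a::ab_group_add \<Rightarrow> 'a) \<Rightarrow> nat \<Rightarrow> ('a \<Rightarrow> 'a \<Rightarrow> 'a) \<Rightarrow> 'a \<Rightarrow> 'a \<Rightarrow> 'a" where
  "nth_derived_op D n \<psi> = (derived_op D ^^ n) \<psi>"

definition derivation ::
    "('k::field \<Rightarrow> 'a::ab_group_add \<Rightarrow> 'a) \<Rightarrow> ('a \<Rightarrow> 'a \<Rightarrow> 'a) \<Rightarrow> ('a \<Rightarrow> 'a) \<Rightarrow> bool" where
  "derivation scale \<psi> d \<longleftrightarrow>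
     Vector_Spaces.linear scale scale d \<and> derived_op d \<psi> = (\<lambda>x y. 0)"

end

theory Submission
  imports Defs
begin

text \<open>Expanding \<open>d (d (\<psi> x y))\<close> by the Leibniz rule twice gives the two outer terms
  \<open>\<psi> (d (d x)) y\<close> and \<open>\<psi> x (d (d y))\<close>, which the derived operation subtracts, and the mixed term
  \<open>\<psi> (d x) (d y)\<close> twice. So one derivation step with respect to \<open>d \<circ> d\<close> turns \<open>\<psi>\<close> into twice its
  pullback along \<open>d\<close> (\<open>derived_op_square_of_derivation\<close>). This step can be iterated because \<open>d \<circ> d\<close>
  is linear and commutes with \<open>d ^^ n\<close>: forming the derived operation then commutes both with
  scaling and with pulling back along \<open>d ^^ n\<close> (\<open>derived_op_scale_pullback\<close>), so each further step
  contributes one more factor \<open>2\<close> and one more \<open>d\<close> in each argument.\<close>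

lemma derivation_Leibniz:
  assumes "derivation scale \<psi> d"
  shows "d (\<psi> x y) = \<psi> (d x) y + \<psi> x (d y)"
proof -
  have "derived_op d \<psi> x y = 0"
    using assms by (simp add: derivation_def)
  then show ?thesis
    by (simp add: derived_op_def algebra_simps)
qed

lemma derived_op_square_of_derivation:
  assumes "derivation scale \<psi> d"
  shows "derived_op (d \<circ> d) \<psi> x y = scale 2 (\<psi> (d x) (d y))"
proof -
  interpret d: Vector_Spaces.linear scale scale d
    using assms by (simp add: derivation_def)
  have "d (d (\<psi> x y)) =
      \<psi> (d (d x)) y + (\<psi> (d x) (d y) + \<psi> (d x) (d y)) + \<psi> x (d (d y))"
    by (simp add: derivation_Leibniz[OF assms] d.add algebra_simps)
  moreover have "scale 2 z = z + z" for z
    using d.vs1.scale_left_distrib[of 1 1 z] by simp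
  ultimately show ?thesis
    by (simp add: derived_op_def)
qed

text \<open>The two subtracted terms apply \<open>\<psi>\<close> to \<open>f (D x)\<close> and \<open>f (D y)\<close>, and commutation turns these
  into \<open>D (f x)\<close> and \<open>D (f y)\<close>; linearity lets the scalar pass through \<open>D\<close>.\<close>

lemma derived_op_scale_pullback:
  assumes "Vector_Spaces.linear scale scale D"
    and commute: "\<And>x. f (D x) = D (f x)"
  shows "derived_op D (\<lambda>x y. scale c (\<psi> (f x) (f y))) x y =
    scale c (derived_op D \<psi> (f x) (f y))"
proof -
  interpret D: Vector_Spaces.linear scale scale D
    by fact
  show ?thesis
    by (simp add: derived_op_def commute D.scale D.vs1.scale_right_diff_distrib)
qed

lemma nth_derived_op_square_of_derivation:
  assumes "derivation scale \<psi> d"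
  shows "nth_derived_op (d \<circ> d) n \<psi> =
    (\<lambda>x y. scale (2 ^ n) (\<psi> ((d ^^ n) x) ((d ^^ n) y)))"
proof -
  have lin: "Vector_Spaces.linear scale scale d"
    using assms by (simp add: derivation_def)
  then interpret d: Vector_Spaces.linear scale scale d .
  have lin2: "Vector_Spaces.linear scale scale (d \<circ> d)"
    using lin lin by (rule Vector_Spaces.linear_compose)
  show ?thesis
  proof (induction n)
    case 0
    show ?case by (simp add: nth_derived_op_def)
  next
    case (Suc n)
    have commute: "(d ^^ n) ((d \<circ> d) x) = (d \<circ> d) ((d ^^ n) x)" for x
      by (simp add: funpow_swap1)
    have "nth_derived_op (d \<circ> d) (Suc n) \<psi> =
        derived_op (d \<circ> d) (\<lambda>x y. scale (2 ^ n) (\<psi> ((d ^^ n) x) ((d ^^ n) y)))"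
      unfolding Suc.IH[symmetric] by (simp add: nth_derived_op_def)
    also have "\<dots> = (\<lambda>x y. scale (2 ^ n) (derived_op (d \<circ> d) \<psi> ((d ^^ n) x) ((d ^^ n) y)))"
      by (intro ext derived_op_scale_pullback lin2 commute)
    also have "\<dots> = (\<lambda>x y. scale (2 ^ Suc n) (\<psi> ((d ^^ Suc n) x) ((d ^^ Suc n) y)))"
      by (simp add: derived_op_square_of_derivation[OF assms] mult.commute)
    finally show ?case .
  qed
qed

theorem proposition3p1:
  fixes scale :: "'k::field \<Rightarrow> 'a::ab_group_add \<Rightarrow> 'a"
    and \<psi> :: "'a \<Rightarrow> 'a \<Rightarrow> 'a"
    and d D :: "'a \<Rightarrow> 'a"
    and n :: nat
  assumes "nonassoc_algebra scale \<psi>"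
    and "derivation scale \<psi> d"
    and "D = d \<circ> d"
    and "n \<ge> 1"
  shows "\<forall>x y. nth_derived_op D n \<psi> x y = scale (2 ^ n) (\<psi> ((d ^^ n) x) ((d ^^ n) y))"
  using nth_derived_op_square_of_derivation[OF assms(2)] by (simp add: assms(3))

end
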